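(* Let $U_1,U_2$ be two ultrametric spaces. Then $U_1$ and $U_2$ are coarse equivalent if and only if there is a common zig-zag $D_+$-chain of their associated $D_+$-chains.
   Context: Metric spaces are nonempty; $\mathbb N=\{1,2,\dots\}$. An ultrametric space is a metric space $(X,d)$ with $d(x,y)\le\max\{d(x,z),d(z,y)\}$ for all $x,y,z$. Coarse equivalence: a map $f\colon X\to Y$ of metric spaces is metrically proper if preimages of bounded sets are bounded; bornologous if for every $R>0$ there is $S>0$ such that $d(x,x')<R$ implies $d(f(x),f(x'))<S$; coarse if both. Two maps $f,g\colon X\to Y$ are close if $\sup_{x\in X}d(f(x),g(x))<\infty$. $X,Y$ are coarse equivalent if there are coarse maps $f\colon X\to Y$, $g\colon Y\to X$ with $g\circ f$ close to $\mathrm{id}_X$ and $f\circ g$ close to $\mathrm{id}_Y$. $D_+$-chain: a sequence of sets $X_n$ ($n\in\mathbb N$) and surjective maps $\Phi_n\colon X_n\to X_{n+1}$ whose direct limit is trivial (a single point); in particular, for all $x_i\in X_i$, $x_j\in X_j$ there is $k>i,j$ such that $x_i$ and $x_j$ have the same image in $X_k$. Subchain: for a (strictly) increasing $\alpha\colon\mathbb N\to\mathbb N$, the $\alpha$-subchain is $(X_{\alpha(n)},\tilde\Phi_n)$ with $\tilde\Phi_n=\Phi_{\alpha(n+1)-1}\circ\cdots\circ\Phi_{\alpha(n)}\colon X_{\alpha(n)}\to X_{\alpha(n+1)}$. Common zig-zag $D_+$-chain: a $D_+$-chain $(Z_n,\mathcal V_n)$ is a common zig-zag $D_+$-chain of $D_+$-chains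 $(X_n,\Phi_n)$ and $(Y_n,\Psi_n)$ if there are increasing $\alpha,\beta\colon\mathbb N\to\mathbb N$ such that $Z_{2n-1}=X_{\alpha(n)}$, $Z_{2n}=Y_{\beta(n)}$ for all $n\ge1$ (so $\mathcal V_{2n-1}\colon X_{\alpha(n)}\to Y_{\beta(n)}$ and $\mathcal V_{2n}\colon Y_{\beta(n)}\to X_{\alpha(n+1)}$), and $\mathcal V_{2n}\circ\mathcal V_{2n-1}=\tilde\Phi_n$, $\mathcal V_{2n+1}\circ\mathcal V_{2n}=\tilde\Psi_n$ for all $n$, where $(X_{\alpha(n)},\tilde\Phi_n)$ and $(Y_{\beta(n)},\tilde\Psi_n)$ are the corresponding subchains. Associated $D_+$-chain of an ultrametric space $U$: for $n\in\mathbb N$, $X_n$ is the partition of $U$ into closed balls of radius $2^n$, and $\Phi_n\colon X_n\to X_{n+1}$ sends a ball to the ball of radius $2^{n+1}$ containing it. *)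

theory Defs
  imports "HOL-Analysis.Abstract_Metric_Spaces" "HOL-Library.FuncSet"
begin

locale ultrametric_space = Metric_space +
  assumes nonempty: "M \<noteq> {}"
    and ultrametric: "\<lbrakk>x \<in> M; y \<in> M; z \<in> M\<rbrakk> \<Longrightarrow> d x y \<le> max (d x z) (d z y)"

section \<open>Coarse equivalence\<close>

definition metrically_proper ::
  "'a set \<Rightarrow> ('a \<Rightarrow> 'a \<Rightarrow> real) \<Rightarrow> 'b set \<Rightarrow> ('b \<Rightarrow> 'b \<Rightarrow> real) \<Rightarrow> ('a \<Rightarrow> 'b) \<Rightarrow> bool" where
  "metrically_proper X d Y e f \<longleftrightarrow>
     (\<forall>B. Metric_space.mbounded Y e B \<longrightarrow> Metric_space.mbounded X d {x \<in> X. f x \<in> B})"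

definition bornologous ::
  "'a set \<Rightarrow> ('a \<Rightarrow> 'a \<Rightarrow> real) \<Rightarrow> 'b set \<Rightarrow> ('b \<Rightarrow> 'b \<Rightarrow> real) \<Rightarrow> ('a \<Rightarrow> 'b) \<Rightarrow> bool" where
  "bornologous X d Y e f \<longleftrightarrow>
     (\<forall>R>0. \<exists>S>0. \<forall>x\<in>X. \<forall>x'\<in>X. d x x' < R \<longrightarrow> e (f x) (f x') < S)"

definition coarse_map ::
  "'a set \<Rightarrow> ('a \<Rightarrow> 'a \<Rightarrow> real) \<Rightarrow> 'b set \<Rightarrow> ('b \<Rightarrow> 'b \<Rightarrow> real) \<Rightarrow> ('a \<Rightarrow> 'b) \<Rightarrow> bool" where
  "coarse_map X d Y e f \<longleftrightarrow>
     f \<in> X \<rightarrow> Y \<and> metrically_proper X d Y e f \<and> bornologous X d Y e f"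

definition close_maps ::
  "'a set \<Rightarrow> ('b \<Rightarrow> 'b \<Rightarrow> real) \<Rightarrow> ('a \<Rightarrow> 'b) \<Rightarrow> ('a \<Rightarrow> 'b) \<Rightarrow> bool" where
  "close_maps X e f g \<longleftrightarrow> bdd_above ((\<lambda>x. e (f x) (g x)) ` X)"

definition coarse_equivalent ::
  "'a set \<Rightarrow> ('a \<Rightarrow> 'a \<Rightarrow> real) \<Rightarrow> 'b set \<Rightarrow> ('b \<Rightarrow> 'b \<Rightarrow> real) \<Rightarrow> bool" where
  "coarse_equivalent X d Y e \<longleftrightarrow>
     (\<exists>f g. coarse_map X d Y e f \<and> coarse_map Y e X d g \<and>
            close_maps X d (g \<circ> f) id \<and> close_maps Y e (f \<circ> g) id)"

section \<open>Chains\<close>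

text \<open>
  All chains are indexed by the positive integers; the values at index \<open>0\<close> and the values of the
  maps \<open>\<Phi> n\<close> outside \<open>X n\<close> are irrelevant.
\<close>

text \<open>The composite \<open>\<Phi> (j - 1) \<circ> \<dots> \<circ> \<Phi> i\<close> from \<open>X i\<close> to \<open>X j\<close>, for \<open>i \<le> j\<close>.\<close>
definition chain_comp :: "(nat \<Rightarrow> 'a \<Rightarrow> 'a) \<Rightarrow> nat \<Rightarrow> nat \<Rightarrow> 'a \<Rightarrow> 'a" where
  "chain_comp \<Phi> i j = fold \<Phi> [i..<j]"

definition direct_limit_rel ::
  "(nat \<Rightarrow> 'a set) \<Rightarrow> (nat \<Rightarrow> 'a \<Rightarrow> 'a) \<Rightarrow> ((nat \<times> 'a) \<times> (nat \<times> 'a)) set" where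
  "direct_limit_rel X \<Phi> =
     {((i, x), (j, y)). (i, x) \<in> Sigma {1..} X \<and> (j, y) \<in> Sigma {1..} X \<and>
        (\<exists>k. i \<le> k \<and> j \<le> k \<and> chain_comp \<Phi> i k x = chain_comp \<Phi> j k y)}"

definition direct_limit ::
  "(nat \<Rightarrow> 'a set) \<Rightarrow> (nat \<Rightarrow> 'a \<Rightarrow> 'a) \<Rightarrow> (nat \<times> 'a) set set" where
  "direct_limit X \<Phi> = Sigma {1..} X // direct_limit_rel X \<Phi>"

definition Dplus_chain :: "(nat \<Rightarrow> 'a set) \<Rightarrow> (nat \<Rightarrow> 'a \<Rightarrow> 'a) \<Rightarrow> bool" where
  "Dplus_chain X \<Phi> \<longleftrightarrow>
     (\<forall>n\<ge>1. \<Phi> n ` X n = X (n + 1)) \<and> is_singleton (direct_limit X \<Phi>)"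

definition increasing :: "(nat \<Rightarrow> nat) \<Rightarrow> bool" where
  "increasing \<alpha> \<longleftrightarrow> \<alpha> \<in> {1..} \<rightarrow> {1..} \<and> strict_mono_on {1..} \<alpha>"

definition subchain_set :: "(nat \<Rightarrow> nat) \<Rightarrow> (nat \<Rightarrow> 'a set) \<Rightarrow> nat \<Rightarrow> 'a set" where
  "subchain_set \<alpha> X n = X (\<alpha> n)"

definition subchain_map :: "(nat \<Rightarrow> nat) \<Rightarrow> (nat \<Rightarrow> 'a \<Rightarrow> 'a) \<Rightarrow> nat \<Rightarrow> 'a \<Rightarrow> 'a" where
  "subchain_map \<alpha> \<Phi> n = chain_comp \<Phi> (\<alpha> n) (\<alpha> (n + 1))"

text \<open>
  The sets of a zig-zag chain alternate between subsets of \<open>'a\<close> and of \<open>'b\<close>. They are realised in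
  the sum type, identifying \<open>X n\<close> with \<open>Inl ` X n\<close> and \<open>Y n\<close> with \<open>Inr ` Y n\<close>.
\<close>
definition common_zigzag ::
  "(nat \<Rightarrow> ('a + 'b) set) \<Rightarrow> (nat \<Rightarrow> 'a + 'b \<Rightarrow> 'a + 'b) \<Rightarrow>
   (nat \<Rightarrow> 'a set) \<Rightarrow> (nat \<Rightarrow> 'a \<Rightarrow> 'a) \<Rightarrow> (nat \<Rightarrow> 'b set) \<Rightarrow> (nat \<Rightarrow> 'b \<Rightarrow> 'b) \<Rightarrow> bool" where
  "common_zigzag Z V X \<Phi> Y \<Psi> \<longleftrightarrow>
     Dplus_chain Z V \<and> Dplus_chain X \<Phi> \<and> Dplus_chain Y \<Psi> \<and>
     (\<exists>\<alpha> \<beta>. increasing \<alpha> \<and> increasing \<beta> \<and>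
        (\<forall>n\<ge>1. Z (2 * n - 1) = Inl ` subchain_set \<alpha> X n \<and>
               Z (2 * n) = Inr ` subchain_set \<beta> Y n \<and>
               (\<forall>x \<in> subchain_set \<alpha> X n.
                  V (2 * n) (V (2 * n - 1) (Inl x)) = Inl (subchain_map \<alpha> \<Phi> n x)) \<and>
               (\<forall>y \<in> subchain_set \<beta> Y n.
                  V (2 * n + 1) (V (2 * n) (Inr y)) = Inr (subchain_map \<beta> \<Psi> n y))))"

section \<open>The chain associated with an ultrametric space\<close>

definition assoc_set :: "'a set \<Rightarrow> ('a \<Rightarrow> 'a \<Rightarrow> real) \<Rightarrow> nat \<Rightarrow> 'a set set" where
  "assoc_set U d n = (\<lambda>x. Metric_space.mcball U d x (2 ^ n)) ` U"

definition assoc_map :: "'a set \<Rightarrow> ('a \<Rightarrow> 'a \<Rightarrow> real) \<Rightarrow> nat \<Rightarrow> 'a set \<Rightarrow> 'a set" where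
  "assoc_map U d n B = (THE C. C \<in> assoc_set U d (n + 1) \<and> B \<subseteq> C)"

context ultrametric_space
begin

lemma mcball_eq:
  assumes "x \<in> M" "y \<in> M" "d x y \<le> r"
  shows "mcball x r = mcball y r"
proof -
  have *: "mcball a r \<subseteq> mcball b r" if "a \<in> M" "b \<in> M" "d a b \<le> r" for a b
  proof
    fix z assume z: "z \<in> mcball a r"
    then have "d b z \<le> max (d b a) (d a z)" using that by (intro ultrametric) auto
    with z that show "z \<in> mcball b r" by (auto simp: commute)
  qed
  show ?thesis using *[of x y] *[of y x] assms by (auto simp: commute)
qed

lemma assoc_map_mcball:
  assumes x: "x \<in> M"
  shows "assoc_map M d n (mcball x (2 ^ n)) = mcball x (2 ^ (n + 1))"
  unfolding assoc_map_def
proof (rule the_equality)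
  have "(2::real) ^ n \<le> 2 ^ (n + 1)" by (rule power_increasing) simp_all
  then have "mcball x (2 ^ n) \<subseteq> mcball x (2 ^ (n + 1))" by (rule mcball_subset_concentric)
  with x show "mcball x (2 ^ (n + 1)) \<in> assoc_set M d (n + 1) \<and>
      mcball x (2 ^ n) \<subseteq> mcball x (2 ^ (n + 1))"
    by (auto simp: assoc_set_def simp del: power_Suc)
next
  fix C assume "C \<in> assoc_set M d (n + 1) \<and> mcball x (2 ^ n) \<subseteq> C"
  then obtain y where y: "y \<in> M" "C = mcball y (2 ^ (n + 1))" "mcball x (2 ^ n) \<subseteq> C"
    by (auto simp: assoc_set_def)
  have "x \<in> mcball x (2 ^ n)" using x by simp
  with y have "x \<in> mcball y (2 ^ (n + 1))" by blast
  then have "d x y \<le> 2 ^ (n + 1)" unfolding in_mcball commute[of x] by blast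
  with x y show "C = mcball x (2 ^ (n + 1))" using mcball_eq by blast
qed

lemma chain_comp_assoc_map:
  assumes "x \<in> M" "i \<le> k"
  shows "chain_comp (assoc_map M d) i k (mcball x (2 ^ i)) = mcball x (2 ^ k)"
  using assms(2)
proof (induction k rule: dec_induct)
  case base
  show ?case by (simp add: chain_comp_def)
next
  case (step k)
  then show ?case using assoc_map_mcball[OF assms(1), of k] by (simp add: chain_comp_def)
qed

lemma Dplus_chain_assoc: "Dplus_chain (assoc_set M d) (assoc_map M d)"
proof -
  have "assoc_map M d n ` assoc_set M d n = assoc_set M d (n + 1)" for n
  proof -
    have "assoc_map M d n ` assoc_set M d n = (\<lambda>x. assoc_map M d n (mcball x (2 ^ n))) ` M"
      by (simp add: assoc_set_def image_image)
    also have "\<dots> = assoc_set M d (n + 1)"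
      unfolding assoc_set_def by (rule image_cong) (simp_all add: assoc_map_mcball del: power_Suc)
    finally show ?thesis .
  qed
  moreover have "is_singleton (direct_limit (assoc_set M d) (assoc_map M d))"
  proof -
    let ?S = "Sigma {1..} (assoc_set M d)"
    have "(p, q) \<in> direct_limit_rel (assoc_set M d) (assoc_map M d)" if pqS: "p \<in> ?S" "q \<in> ?S" for p q
    proof -
      obtain i B j C where pq: "p = (i, B)" "B \<in> assoc_set M d i" "q = (j, C)" "C \<in> assoc_set M d j"
        using pqS by (elim SigmaE) simp
      obtain x where x: "x \<in> M" "B = mcball x (2 ^ i)" using pq(2) unfolding assoc_set_def by blast
      obtain y where y: "y \<in> M" "C = mcball y (2 ^ j)" using pq(4) unfolding assoc_set_def by blast
      have p: "p = (i, mcball x (2 ^ i))" "x \<in> M" and q: "q = (j, mcball y (2 ^ j))" "y \<in> M"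
        using pq x y by simp_all
      obtain l where l: "d x y < 2 ^ l" using real_arch_pow[of 2 "d x y"] by auto
      define k where "k = max l (max i j)"
      have ik: "i \<le> k" and jk: "j \<le> k" by (auto simp: k_def)
      have "(2::real) ^ l \<le> 2 ^ k" by (rule power_increasing) (simp_all add: k_def)
      with l have "d x y \<le> 2 ^ k" by linarith
      then have "chain_comp (assoc_map M d) i k (mcball x (2 ^ i)) =
          chain_comp (assoc_map M d) j k (mcball y (2 ^ j))"
        using chain_comp_assoc_map[OF p(2) ik] chain_comp_assoc_map[OF q(2) jk]
          mcball_eq[OF p(2) q(2)] by simp
      with pqS ik jk show ?thesis unfolding direct_limit_rel_def p q by blast
    qed
    moreover have "direct_limit_rel (assoc_set M d) (assoc_map M d) \<subseteq> ?S \<times> ?S"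
      by (auto simp: direct_limit_rel_def)
    ultimately have "direct_limit_rel (assoc_set M d) (assoc_map M d) = ?S \<times> ?S" by auto
    moreover have "?S \<noteq> {}"
    proof -
      obtain x where "x \<in> M" using nonempty by blast
      then have "(1, mcball x (2 ^ 1)) \<in> ?S" unfolding assoc_set_def by blast
      then show ?thesis by blast
    qed
    ultimately have "direct_limit (assoc_set M d) (assoc_map M d) = {?S}"
      unfolding direct_limit_def quotient_def by auto
    then show ?thesis by simp
  qed
  ultimately show ?thesis by (simp add: Dplus_chain_def)
qed

end

end

theory Submission imports Defs begin

text \<open>
  In an ultrametric space two closed balls of the same radius are equal or disjoint, so a map
  \<open>f\<close> sends balls of radius \<open>s\<close> to balls of radius \<open>r\<close> in a well-defined way as soon as
  \<open>d x x' \<le> s\<close> implies \<open>d (f x) (f x') \<le> r\<close>. Bornologous maps therefore act on the levels of the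
  associated chains, at the price of passing to higher levels, and this is the whole link between
  the two sides of the theorem.

  Given a coarse equivalence \<open>f\<close>, \<open>g\<close>, let \<open>F\<close> and \<open>G\<close> be functions on levels such that \<open>f\<close> maps
  balls of level \<open>n\<close> into balls of level \<open>F n\<close>, and \<open>g\<close> those of level \<open>n\<close> into level \<open>G n\<close>. They
  can be taken with \<open>n < F n\<close>, \<open>n < G n\<close> and all their values so large that the two closeness
  constants are at most \<open>2 ^ F n\<close> and \<open>2 ^ G n\<close> (\<open>bornologous_levels\<close>). Climbing by \<open>F\<close> and \<open>G\<close>
  alternately gives the levels \<open>\<alpha> 1 < \<beta> 1 < \<alpha> 2 < \<dots>\<close> of the zig-zag, whose maps are induced by \<open>f\<close>
  and \<open>g\<close>. Closeness to the identity makes the induced maps surjective and makes their composites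
  agree with the inclusion of balls. That the zig-zag has trivial direct limit is automatic,
  because one of the chains that it interleaves is cofinal in it (\<open>Dplus_chain_zigzag\<close>).

  Conversely, given a zig-zag \<open>V\<close>, let \<open>f x\<close> be any point of the ball to which \<open>V 1\<close> sends the
  ball of \<open>x\<close>, and obtain \<open>g\<close> from \<open>V 2\<close> in the same way. The commutation relations propagate this
  to all levels: every odd map of the zig-zag is induced by \<open>f\<close> and every even one by \<open>g\<close>. As the
  levels are unbounded, \<open>f\<close> and \<open>g\<close> are bornologous, and comparing composites on the first levels
  shows that \<open>f\<close> and \<open>g\<close> are inverse to each other up to bounded distance. Properness needs no
  separate argument, since a bornologous inverse up to closeness forces it
  (\<open>metrically_proper_if_coarse_inverse\<close>).
\<close>

section \<open>Coarse maps\<close>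

text \<open>
  If \<open>f x\<close> and \<open>f x'\<close> are within \<open>R\<close>, then their images under \<open>g\<close> are within some \<open>S\<close> that
  depends only on \<open>R\<close>, and those images are uniformly close to \<open>x\<close> and \<open>x'\<close>.
\<close>
lemma metrically_proper_if_coarse_inverse:
  assumes "Metric_space U d" "Metric_space W e"
    and f: "f \<in> U \<rightarrow> W" and g: "g \<in> W \<rightarrow> U"
    and born: "bornologous W e U d g"
    and close: "close_maps U d (g \<circ> f) id"
  shows "metrically_proper U d W e f"
  unfolding metrically_proper_def
proof (intro allI impI)
  interpret X: Metric_space U d by fact
  interpret Y: Metric_space W e by fact
  fix B assume "Y.mbounded B"
  then obtain R where R: "\<And>y y'. y \<in> B \<Longrightarrow> y' \<in> B \<Longrightarrow> e y y' \<le> R" "R > 0"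
    by (auto simp: Y.mbounded_alt_pos)
  obtain S where S: "\<And>y y'. y \<in> W \<Longrightarrow> y' \<in> W \<Longrightarrow> e y y' < R + 1 \<Longrightarrow> d (g y) (g y') < S"
    using born R(2) unfolding bornologous_def by (metis add_pos_pos zero_less_one)
  obtain C where C: "\<And>x. x \<in> U \<Longrightarrow> d (g (f x)) x \<le> C"
    using close unfolding close_maps_def bdd_above_def by auto
  have "d x x' \<le> C + S + C" if x: "x \<in> U" "f x \<in> B" and x': "x' \<in> U" "f x' \<in> B" for x x'
  proof -
    have gf: "g (f x) \<in> U" "g (f x') \<in> U" and fW: "f x \<in> W" "f x' \<in> W" using f g x x' by auto
    have "d (g (f x)) (g (f x')) < S" using S[OF fW] R(1)[OF x(2) x'(2)] by simp
    moreover have "d x x' \<le> d x (g (f x)) + d (g (f x)) x'"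
      and "d (g (f x)) x' \<le> d (g (f x)) (g (f x')) + d (g (f x')) x'"
      using x x' gf by (auto intro: X.triangle)
    ultimately show ?thesis using C[OF x(1)] C[OF x'(1)] X.commute[of x "g (f x)"] by linarith
  qed
  then show "X.mbounded {x \<in> U. f x \<in> B}" unfolding X.mbounded_alt by blast
qed

lemma coarse_equivalentI:
  assumes "Metric_space U d" "Metric_space W e"
    and "f \<in> U \<rightarrow> W" "g \<in> W \<rightarrow> U"
    and "bornologous U d W e f" "bornologous W e U d g"
    and "close_maps U d (g \<circ> f) id" "close_maps W e (f \<circ> g) id"
  shows "coarse_equivalent U d W e"
  unfolding coarse_equivalent_def coarse_map_def
  using assms metrically_proper_if_coarse_inverse[of U d W e f g]
    metrically_proper_if_coarse_inverse[of W e U d g f] by blast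

lemma close_maps_idI:
  assumes "\<And>x. x \<in> U \<Longrightarrow> d (h x) x \<le> C"
  shows "close_maps U d h id"
  unfolding close_maps_def using assms by (intro bdd_aboveI2[where M = C]) auto

lemma bornologousI_levels:
  fixes \<alpha> \<beta> :: "nat \<Rightarrow> nat"
  assumes unbounded: "\<And>n. n \<ge> 1 \<Longrightarrow> n \<le> \<alpha> n"
    and levels: "\<And>n x x'. \<lbrakk>n \<ge> 1; x \<in> U; x' \<in> U; d x x' \<le> 2 ^ \<alpha> n\<rbrakk> \<Longrightarrow> e (f x) (f x') \<le> 2 ^ \<beta> n"
  shows "bornologous U d W e f"
  unfolding bornologous_def
proof (intro allI impI)
  fix R :: real
  obtain l where l: "R < 2 ^ l" using real_arch_pow[of 2 R] by auto
  define n where "n = max 1 l"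
  have n: "n \<ge> 1" by (simp add: n_def)
  have "l \<le> \<alpha> n" using unbounded[OF n] by (simp add: n_def)
  then have "(2::real) ^ l \<le> 2 ^ \<alpha> n" by (rule power_increasing) simp
  with l have "R \<le> 2 ^ \<alpha> n" by linarith
  then have "e (f x) (f x') < 2 ^ \<beta> n + 1" if "x \<in> U" "x' \<in> U" "d x x' < R" for x x'
    using levels[OF n that(1,2)] that(3) by simp
  moreover have "(2::real) ^ \<beta> n + 1 > 0" by (simp add: add_pos_pos)
  ultimately show "\<exists>S>0. \<forall>x\<in>U. \<forall>x'\<in>U. d x x' < R \<longrightarrow> e (f x) (f x') < S" by blast
qed

text \<open>
  Any larger level serves as well as a given one, so the levels can be made to exceed \<open>n\<close> and a
  prescribed constant. This is what makes the sequences of the zig-zag strictly increasing and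
  what absorbs the closeness constants.
\<close>
lemma bornologous_levels:
  fixes C :: real
  assumes "bornologous U d W e f"
  obtains F :: "nat \<Rightarrow> nat" where "\<And>n. n < F n" "\<And>n. C \<le> 2 ^ F n"
    "\<And>n x x'. \<lbrakk>x \<in> U; x' \<in> U; d x x' \<le> 2 ^ n\<rbrakk> \<Longrightarrow> e (f x) (f x') \<le> 2 ^ F n"
proof -
  have "\<exists>m>n. C \<le> 2 ^ m \<and> (\<forall>x\<in>U. \<forall>x'\<in>U. d x x' \<le> 2 ^ n \<longrightarrow> e (f x) (f x') \<le> 2 ^ m)" for n :: nat
  proof -
    have "(2::real) ^ n + 1 > 0" by (simp add: add_pos_pos)
    then obtain S where S: "\<And>x x'. \<lbrakk>x \<in> U; x' \<in> U; d x x' < 2 ^ n + 1\<rbrakk> \<Longrightarrow> e (f x) (f x') < S"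
      using assms unfolding bornologous_def by meson
    obtain l where l: "max C S < 2 ^ l" using real_arch_pow[of 2 "max C S"] by auto
    have "(2::real) ^ l \<le> 2 ^ max l (Suc n)" by (rule power_increasing) simp_all
    with l have "C \<le> 2 ^ max l (Suc n)" "S \<le> 2 ^ max l (Suc n)" by linarith+
    moreover have "e (f x) (f x') < S" if "x \<in> U" "x' \<in> U" "d x x' \<le> 2 ^ n" for x x'
      using S[OF that(1,2)] that(3) by simp
    ultimately show ?thesis by (intro exI[of _ "max l (Suc n)"]) fastforce
  qed
  then show ?thesis using that by metis
qed

section \<open>Chains\<close>

lemma chain_comp_self [simp]: "chain_comp \<Phi> i i x = x"
  by (simp add: chain_comp_def)

lemma chain_comp_Suc: "i \<le> j \<Longrightarrow> chain_comp \<Phi> i (Suc j) x = \<Phi> j (chain_comp \<Phi> i j x)"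
  by (simp add: chain_comp_def)

lemma chain_comp_trans:
  assumes "i \<le> j" "j \<le> k"
  shows "chain_comp \<Phi> j k (chain_comp \<Phi> i j x) = chain_comp \<Phi> i k x"
  using assms(2)
proof (induction k rule: dec_induct)
  case (step k)
  then show ?case using assms(1) by (simp add: chain_comp_Suc)
qed simp

lemma chain_comp_in:
  assumes "\<And>n. n \<ge> 1 \<Longrightarrow> \<Phi> n ` X n = X (n + 1)" "1 \<le> i" "i \<le> j" "x \<in> X i"
  shows "chain_comp \<Phi> i j x \<in> X j"
  using assms(3)
proof (induction j rule: dec_induct)
  case (step j)
  then show ?case using assms(1)[of j] assms(2) by (auto simp: chain_comp_Suc)
qed (simp add: assms(4))

lemma is_singleton_quotient_iff:
  assumes "r \<subseteq> S \<times> S" and refl: "\<And>p. p \<in> S \<Longrightarrow> (p, p) \<in> r"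
  shows "is_singleton (S // r) \<longleftrightarrow> S \<noteq> {} \<and> r = S \<times> S"
proof
  assume "is_singleton (S // r)"
  then obtain A where A: "S // r = {A}" unfolding is_singleton_def by blast
  then have cls: "r `` {p} = A" if "p \<in> S" for p using quotientI[OF that, of r] by blast
  have "(p, q) \<in> r" if "p \<in> S" "q \<in> S" for p q
    using cls[OF that(1)] cls[OF that(2)] refl[OF that(2)] by blast
  then show "S \<noteq> {} \<and> r = S \<times> S" using assms(1) A by (auto simp: quotient_def)
next
  assume "S \<noteq> {} \<and> r = S \<times> S"
  then have "S // r = {S}" unfolding quotient_def by blast
  then show "is_singleton (S // r)" by simp
qed

lemma is_singleton_direct_limit_iff:
  "is_singleton (direct_limit X \<Phi>) \<longleftrightarrow>
     Sigma {1..} X \<noteq> {} \<and> direct_limit_rel X \<Phi> = Sigma {1..} X \<times> Sigma {1..} X"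
  unfolding direct_limit_def
  by (rule is_singleton_quotient_iff) (auto simp: direct_limit_rel_def)

lemma increasing_ge:
  assumes "increasing \<alpha>" "1 \<le> n"
  shows "n \<le> \<alpha> n"
  using assms(2)
proof (induction n rule: dec_induct)
  case base
  then show ?case using assms(1) by (auto simp: increasing_def Pi_iff)
next
  case (step n)
  then have "\<alpha> n < \<alpha> (Suc n)"
    using assms(1) by (auto simp: increasing_def strict_mono_on_def)
  with step show ?case by simp
qed

lemma increasing_mono: "increasing \<alpha> \<Longrightarrow> 1 \<le> m \<Longrightarrow> m \<le> n \<Longrightarrow> \<alpha> m \<le> \<alpha> n"
  by (auto simp: increasing_def intro: strict_mono_on_leD)

lemma increasing_if_strict_mono:
  assumes "strict_mono \<alpha>"
  shows "increasing \<alpha>"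
proof -
  have "1 \<le> \<alpha> n" if "1 \<le> n" for n
    using strict_mono_imp_increasing[OF assms, of n] that by linarith
  moreover have "strict_mono_on {1..} \<alpha>"
    using assms by (simp add: strict_mono_on_def strict_mono_def)
  ultimately show ?thesis by (auto simp: increasing_def)
qed

text \<open>
  The odd positions are cofinal in the zig-zag: any two of its elements can be pushed
  to a common odd position, where they are elements of \<open>X\<close> and merge because \<open>X\<close> has trivial
  direct limit.
\<close>
lemma Dplus_chain_zigzag:
  assumes X: "Dplus_chain X \<Phi>" and \<alpha>: "increasing \<alpha>"
    and odd: "\<And>n. n \<ge> 1 \<Longrightarrow> Z (2 * n - 1) = Inl ` X (\<alpha> n)"
    and surj: "\<And>n. n \<ge> 1 \<Longrightarrow> V n ` Z n = Z (n + 1)"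
    and comp: "\<And>n x. \<lbrakk>n \<ge> 1; x \<in> X (\<alpha> n)\<rbrakk> \<Longrightarrow>
      V (2 * n) (V (2 * n - 1) (Inl x)) = Inl (subchain_map \<alpha> \<Phi> n x)"
  shows "Dplus_chain Z V"
proof -
  have surjX: "\<And>n. n \<ge> 1 \<Longrightarrow> \<Phi> n ` X n = X (n + 1)"
    and limX: "Sigma {1..} X \<noteq> {}" "direct_limit_rel X \<Phi> = Sigma {1..} X \<times> Sigma {1..} X"
    using X by (auto simp: Dplus_chain_def is_singleton_direct_limit_iff)
  have \<alpha>1: "1 \<le> \<alpha> n" if "1 \<le> n" for n using increasing_ge[OF \<alpha> that] that by simp
  have odd_comp: "chain_comp V (2 * n - 1) (2 * m - 1) (Inl x) = Inl (chain_comp \<Phi> (\<alpha> n) (\<alpha> m) x)"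
    if n: "1 \<le> n" and nm: "n \<le> m" and x: "x \<in> X (\<alpha> n)" for n m x
    using nm
  proof (induction m rule: dec_induct)
    case (step m)
    let ?y = "chain_comp \<Phi> (\<alpha> n) (\<alpha> m) x"
    have y: "?y \<in> X (\<alpha> m)"
      using chain_comp_in[of \<Phi> X, OF surjX \<alpha>1[OF n] increasing_mono[OF \<alpha> n step(1)] x] .
    have le: "2 * n - 1 \<le> 2 * m - 1" and Sucs: "Suc (2 * m - 1) = 2 * m" "2 * Suc m - 1 = Suc (2 * m)"
      using n step(1) by auto
    have "chain_comp V (2 * n - 1) (2 * m) (Inl x) = V (2 * m - 1) (Inl ?y)"
      using chain_comp_Suc[OF le, of V "Inl x"] step.IH unfolding Sucs by simp
    moreover have "2 * n - 1 \<le> 2 * m" using le by simp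
    ultimately have "chain_comp V (2 * n - 1) (2 * Suc m - 1) (Inl x) = V (2 * m) (V (2 * m - 1) (Inl ?y))"
      unfolding Sucs by (simp add: chain_comp_Suc)
    also have "\<dots> = Inl (subchain_map \<alpha> \<Phi> m ?y)" using comp y n step by simp
    also have "subchain_map \<alpha> \<Phi> m ?y = chain_comp \<Phi> (\<alpha> n) (\<alpha> (Suc m)) x"
      unfolding subchain_map_def
      using chain_comp_trans[OF increasing_mono[OF \<alpha> n step(1)] increasing_mono[OF \<alpha>, of m "Suc m"]]
        n step(1) by simp
    finally show ?case .
  qed simp
  have "(p, q) \<in> direct_limit_rel Z V" if p: "p \<in> Sigma {1..} Z" and q: "q \<in> Sigma {1..} Z" for p q
  proof -
    obtain i z j w where pq: "p = (i, z)" "1 \<le> i" "z \<in> Z i" "q = (j, w)" "1 \<le> j" "w \<in> Z j"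
      using p q by auto
    define m where "m = i + j"
    have m: "1 \<le> m" "i \<le> 2 * m - 1" "j \<le> 2 * m - 1" using pq by (auto simp: m_def)
    obtain x where x: "x \<in> X (\<alpha> m)" "chain_comp V i (2 * m - 1) z = Inl x"
      using chain_comp_in[of V Z, OF surj pq(2) m(2) pq(3)] odd[OF m(1)] by auto
    obtain y where y: "y \<in> X (\<alpha> m)" "chain_comp V j (2 * m - 1) w = Inl y"
      using chain_comp_in[of V Z, OF surj pq(5) m(3) pq(6)] odd[OF m(1)] by auto
    have "((\<alpha> m, x), (\<alpha> m, y)) \<in> direct_limit_rel X \<Phi>"
      unfolding limX(2) using x(1) y(1) \<alpha>1[OF m(1)] by simp
    then obtain k where k: "\<alpha> m \<le> k" "chain_comp \<Phi> (\<alpha> m) k x = chain_comp \<Phi> (\<alpha> m) k y"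
      by (auto simp: direct_limit_rel_def)
    define l where "l = max m k"
    have l: "m \<le> l" "k \<le> \<alpha> l" using increasing_ge[OF \<alpha>, of l] m(1) by (auto simp: l_def)
    have "chain_comp \<Phi> (\<alpha> m) (\<alpha> l) x = chain_comp \<Phi> (\<alpha> m) (\<alpha> l) y"
      using chain_comp_trans[OF k(1) l(2), of \<Phi>] k(2) by metis
    then have "chain_comp V (2 * m - 1) (2 * l - 1) (Inl x) = chain_comp V (2 * m - 1) (2 * l - 1) (Inl y)"
      using odd_comp[OF m(1) l(1)] x(1) y(1) by simp
    moreover have ml: "2 * m - 1 \<le> 2 * l - 1" using l(1) by simp
    ultimately have "chain_comp V i (2 * l - 1) z = chain_comp V j (2 * l - 1) w"
      using chain_comp_trans[OF m(2) ml, of V z] chain_comp_trans[OF m(3) ml, of V w] x(2) y(2)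
      by simp
    then show ?thesis
      using p q m ml unfolding direct_limit_rel_def pq by (auto intro!: exI[of _ "2 * l - 1"])
  qed
  moreover have "direct_limit_rel Z V \<subseteq> Sigma {1..} Z \<times> Sigma {1..} Z"
    by (auto simp: direct_limit_rel_def)
  ultimately have "direct_limit_rel Z V = Sigma {1..} Z \<times> Sigma {1..} Z" by auto
  moreover have "Sigma {1..} Z \<noteq> {}"
  proof -
    obtain i x where ix: "1 \<le> i" "x \<in> X i" using limX(1) by auto
    have "chain_comp \<Phi> i (\<alpha> i) x \<in> X (\<alpha> i)"
      using chain_comp_in[of \<Phi> X, OF surjX ix(1) increasing_ge[OF \<alpha> ix(1)] ix(2)] .
    then have "Inl (chain_comp \<Phi> i (\<alpha> i) x) \<in> Z (2 * i - 1)" using odd[OF ix(1)] by simp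
    then have "(2 * i - 1, Inl (chain_comp \<Phi> i (\<alpha> i) x)) \<in> Sigma {1..} Z"
      using ix(1) by (intro SigmaI) auto
    then show ?thesis by blast
  qed
  ultimately show ?thesis using surj by (simp add: Dplus_chain_def is_singleton_direct_limit_iff)
qed

section \<open>Maps induced on balls\<close>

context ultrametric_space
begin

lemma subchain_map_assoc_mcball:
  assumes "x \<in> M" "increasing \<alpha>" "1 \<le> n"
  shows "subchain_map \<alpha> (assoc_map M d) n (mcball x (2 ^ \<alpha> n)) = mcball x (2 ^ \<alpha> (n + 1))"
  unfolding subchain_map_def
  using chain_comp_assoc_map[OF assms(1) increasing_mono[OF assms(2,3), of "n + 1"]] by simp

lemma mcball_eq_iff:
  assumes "x \<in> M" "y \<in> M" "0 \<le> r"
  shows "mcball x r = mcball y r \<longleftrightarrow> d x y \<le> r"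
proof
  assume "mcball x r = mcball y r"
  then have "y \<in> mcball x r" using assms by simp
  then show "d x y \<le> r" by simp
qed (rule mcball_eq[OF assms(1,2)])

text \<open>
  This is where surjectivity of the maps of a zig-zag comes from: \<open>f\<close> need not be surjective, but
  if its image is \<open>r\<close>-dense, its values are centres of all balls of radius \<open>r\<close>.
\<close>
lemma mcball_image_eq:
  assumes "f \<in> U \<rightarrow> M" "g \<in> M \<rightarrow> U" "\<And>y. y \<in> M \<Longrightarrow> d (f (g y)) y \<le> r"
  shows "(\<lambda>x. mcball (f x) r) ` U = (\<lambda>y. mcball y r) ` M"
proof
  show "(\<lambda>x. mcball (f x) r) ` U \<subseteq> (\<lambda>y. mcball y r) ` M" using assms(1) by auto
  show "(\<lambda>y. mcball y r) ` M \<subseteq> (\<lambda>x. mcball (f x) r) ` U"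
  proof
    fix C assume "C \<in> (\<lambda>y. mcball y r) ` M"
    then obtain y where y: "y \<in> M" "C = mcball y r" by blast
    then have "C = mcball (f (g y)) r" "g y \<in> U"
      using mcball_eq[of "f (g y)" y r] assms by auto
    then show "C \<in> (\<lambda>x. mcball (f x) r) ` U" by blast
  qed
qed

end

text \<open>
  A ball has no distinguished centre in an ultrametric space, so the map that \<open>f\<close> induces on balls
  is defined through an arbitrary point; \<open>ball_map_mcball\<close> shows independence of that choice.
\<close>
definition ball_map ::
  "'b set \<Rightarrow> ('b \<Rightarrow> 'b \<Rightarrow> real) \<Rightarrow> ('a \<Rightarrow> 'b) \<Rightarrow> real \<Rightarrow> 'a set \<Rightarrow> 'b set" where
  "ball_map W e f r B = Metric_space.mcball W e (f (SOME x. x \<in> B)) r"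

lemma ball_map_mcball:
  assumes "Metric_space U d" "ultrametric_space W e" "f \<in> U \<rightarrow> W" "x \<in> U" "0 \<le> s"
    and control: "\<And>x x'. \<lbrakk>x \<in> U; x' \<in> U; d x x' \<le> s\<rbrakk> \<Longrightarrow> e (f x) (f x') \<le> r"
  shows "ball_map W e f r (Metric_space.mcball U d x s) = Metric_space.mcball W e (f x) r"
proof -
  interpret X: Metric_space U d by fact
  interpret Y: ultrametric_space W e by fact
  let ?s = "SOME x'. x' \<in> X.mcball x s"
  have "x \<in> X.mcball x s" using assms by simp
  then have "?s \<in> X.mcball x s" by (rule someI)
  then have "?s \<in> U" "d x ?s \<le> s" by auto
  then have "Y.mcball (f x) r = Y.mcball (f ?s) r"
    using assms(3,4) control[of x ?s] by (intro Y.mcball_eq) auto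
  then show ?thesis by (simp add: ball_map_def)
qed

section \<open>From coarse equivalences to zig-zags and back\<close>

lemma common_zigzag_if_coarse_equivalent:
  assumes "ultrametric_space U d" "ultrametric_space W e"
    and "coarse_equivalent U d W e"
  shows "\<exists>Z V. common_zigzag Z V (assoc_set U d) (assoc_map U d) (assoc_set W e) (assoc_map W e)"
proof -
  interpret X: ultrametric_space U d by fact
  interpret Y: ultrametric_space W e by fact
  obtain f g where fg: "f \<in> U \<rightarrow> W" "g \<in> W \<rightarrow> U"
    and bf: "bornologous U d W e f" and bg: "bornologous W e U d g"
    and close: "close_maps U d (g \<circ> f) id" "close_maps W e (f \<circ> g) id"
    using assms(3) unfolding coarse_equivalent_def coarse_map_def by blast
  obtain C where C: "\<And>x. x \<in> U \<Longrightarrow> d (g (f x)) x \<le> C"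
    using close(1) unfolding close_maps_def bdd_above_def by auto
  obtain D where D: "\<And>y. y \<in> W \<Longrightarrow> e (f (g y)) y \<le> D"
    using close(2) unfolding close_maps_def bdd_above_def by auto
  obtain F where F: "\<And>n. n < F n" "\<And>n. D \<le> 2 ^ F n"
    "\<And>n x x'. \<lbrakk>x \<in> U; x' \<in> U; d x x' \<le> 2 ^ n\<rbrakk> \<Longrightarrow> e (f x) (f x') \<le> 2 ^ F n"
    using bornologous_levels[OF bf, of D] by blast
  obtain G where G: "\<And>n. n < G n" "\<And>n. C \<le> 2 ^ G n"
    "\<And>n y y'. \<lbrakk>y \<in> W; y' \<in> W; e y y' \<le> 2 ^ n\<rbrakk> \<Longrightarrow> d (g y) (g y') \<le> 2 ^ G n"
    using bornologous_levels[OF bg, of C] by blast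
  define \<alpha> where "\<alpha> n = ((G \<circ> F) ^^ n) 0" for n
  define \<beta> where "\<beta> n = F (\<alpha> n)" for n
  have \<alpha>_Suc: "\<alpha> (Suc n) = G (\<beta> n)" for n by (simp add: \<alpha>_def \<beta>_def)
  have lt: "\<alpha> n < \<beta> n" "\<beta> n < \<alpha> (Suc n)" for n
    using F(1) G(1) by (simp_all add: \<alpha>_Suc \<beta>_def)
  have "strict_mono \<alpha>" unfolding strict_mono_Suc_iff using lt less_trans by blast
  moreover have "strict_mono \<beta>" unfolding strict_mono_Suc_iff using lt less_trans by blast
  ultimately have inc: "increasing \<alpha>" "increasing \<beta>"
    by (auto intro: increasing_if_strict_mono)
  \<comment> \<open>Position \<open>2 * n - 1\<close> carries level \<open>\<alpha> n\<close>, position \<open>2 * n\<close> carries level \<open>\<beta> n\<close>; each map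
      takes its radius from the next position.\<close>
  define Z where "Z n = (if odd n then Inl ` assoc_set U d (\<alpha> (Suc n div 2))
    else Inr ` assoc_set W e (\<beta> (n div 2)))" for n
  define V where "V n = case_sum (\<lambda>B. Inr (ball_map W e f (2 ^ \<beta> (Suc n div 2)) B))
    (\<lambda>B. Inl (ball_map U d g (2 ^ \<alpha> (Suc (n div 2))) B))" for n
  have Zodd: "Z (2 * n - 1) = Inl ` assoc_set U d (\<alpha> n)" if "n \<ge> 1" for n
    using that by (simp add: Z_def)
  have Zeven: "Z (2 * n) = Inr ` assoc_set W e (\<beta> n)" for n
    by (simp add: Z_def)
  have Vodd: "V (2 * n - 1) (Inl (X.mcball x (2 ^ \<alpha> n))) = Inr (Y.mcball (f x) (2 ^ \<beta> n))"
    if "n \<ge> 1" "x \<in> U" for n x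
    using that F(3) ball_map_mcball[OF X.Metric_space_axioms assms(2) fg(1)]
    by (simp add: V_def \<beta>_def)
  have Veven: "V (2 * n) (Inr (Y.mcball y (2 ^ \<beta> n))) = Inl (X.mcball (g y) (2 ^ \<alpha> (Suc n)))"
    if "y \<in> W" for n y
    using that G(3) ball_map_mcball[OF Y.Metric_space_axioms assms(1) fg(2)]
    by (simp add: V_def \<alpha>_Suc)
  have Vodd_image: "V (2 * n - 1) ` Z (2 * n - 1) = Z (2 * n)" if n: "n \<ge> 1" for n
  proof -
    have "e (f (g y)) y \<le> 2 ^ \<beta> n" if "y \<in> W" for y
      using D[OF that] F(2)[of "\<alpha> n"] by (simp add: \<beta>_def)
    then have *: "(\<lambda>x. Y.mcball (f x) (2 ^ \<beta> n)) ` U = assoc_set W e (\<beta> n)"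
      unfolding assoc_set_def by (rule Y.mcball_image_eq[OF fg])
    have "V (2 * n - 1) ` Z (2 * n - 1) = (\<lambda>x. Inr (Y.mcball (f x) (2 ^ \<beta> n))) ` U"
      unfolding Zodd[OF n] assoc_set_def image_image
      by (rule image_cong[OF refl Vodd[OF n]])
    then show ?thesis unfolding Zeven *[symmetric] image_image .
  qed
  have Veven_image: "V (2 * n) ` Z (2 * n) = Z (2 * n + 1)" for n
  proof -
    have "d (g (f x)) x \<le> 2 ^ \<alpha> (Suc n)" if "x \<in> U" for x
      using C[OF that] G(2)[of "\<beta> n"] by (simp add: \<alpha>_Suc)
    then have *: "(\<lambda>y. X.mcball (g y) (2 ^ \<alpha> (Suc n))) ` W = assoc_set U d (\<alpha> (Suc n))"
      unfolding assoc_set_def by (rule X.mcball_image_eq[OF fg(2,1)])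
    have "V (2 * n) ` Z (2 * n) = (\<lambda>y. Inl (X.mcball (g y) (2 ^ \<alpha> (Suc n)))) ` W"
      unfolding Zeven assoc_set_def image_image
      by (rule image_cong[OF refl Veven])
    moreover have "Z (2 * n + 1) = Inl ` assoc_set U d (\<alpha> (Suc n))" using Zodd[of "Suc n"] by simp
    ultimately show ?thesis unfolding *[symmetric] image_image by simp
  qed
  have comp_left: "V (2 * n) (V (2 * n - 1) (Inl B)) = Inl (subchain_map \<alpha> (assoc_map U d) n B)"
    if n: "n \<ge> 1" and B: "B \<in> assoc_set U d (\<alpha> n)" for n B
  proof -
    obtain x where x: "x \<in> U" "B = X.mcball x (2 ^ \<alpha> n)" using B by (auto simp: assoc_set_def)
    have "V (2 * n) (V (2 * n - 1) (Inl B)) = Inl (X.mcball (g (f x)) (2 ^ \<alpha> (Suc n)))"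
      using Vodd[OF n x(1)] Veven[of "f x" n] fg(1) x by auto
    also have "d (g (f x)) x \<le> 2 ^ \<alpha> (Suc n)"
      using C[OF x(1)] G(2)[of "\<beta> n"] by (simp add: \<alpha>_Suc)
    then have "X.mcball (g (f x)) (2 ^ \<alpha> (Suc n)) = X.mcball x (2 ^ \<alpha> (Suc n))"
      using X.mcball_eq x(1) fg by blast
    finally show ?thesis using X.subchain_map_assoc_mcball[OF x(1) inc(1) n] x(2) by simp
  qed
  have comp_right: "V (2 * n + 1) (V (2 * n) (Inr B)) = Inr (subchain_map \<beta> (assoc_map W e) n B)"
    if n: "n \<ge> 1" and B: "B \<in> assoc_set W e (\<beta> n)" for n B
  proof -
    obtain y where y: "y \<in> W" "B = Y.mcball y (2 ^ \<beta> n)" using B by (auto simp: assoc_set_def)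
    have "V (2 * n + 1) (V (2 * n) (Inr B)) = Inr (Y.mcball (f (g y)) (2 ^ \<beta> (Suc n)))"
      using Vodd[of "Suc n" "g y"] Veven[OF y(1), of n] fg(2) y by auto
    also have "e (f (g y)) y \<le> 2 ^ \<beta> (Suc n)"
      using D[OF y(1)] F(2)[of "\<alpha> (Suc n)"] by (simp add: \<beta>_def)
    then have "Y.mcball (f (g y)) (2 ^ \<beta> (Suc n)) = Y.mcball y (2 ^ \<beta> (Suc n))"
      using Y.mcball_eq y(1) fg by blast
    finally show ?thesis using Y.subchain_map_assoc_mcball[OF y(1) inc(2) n] y(2) by simp
  qed
  have "V n ` Z n = Z (n + 1)" if "n \<ge> 1" for n
  proof (cases "even n")
    case True
    then show ?thesis using Veven_image by (auto elim!: evenE)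
  next
    case False
    then obtain m where "n = 2 * m + 1" by (rule oddE)
    then show ?thesis using Vodd_image[of "Suc m"] by simp
  qed
  then have "Dplus_chain Z V"
    using Dplus_chain_zigzag[OF X.Dplus_chain_assoc inc(1), of Z V] Zodd comp_left by blast
  then have "common_zigzag Z V (assoc_set U d) (assoc_map U d) (assoc_set W e) (assoc_map W e)"
    unfolding common_zigzag_def subchain_set_def
    using X.Dplus_chain_assoc Y.Dplus_chain_assoc inc Zodd Zeven comp_left comp_right by blast
  then show ?thesis by blast
qed

lemma coarse_equivalent_if_common_zigzag:
  assumes "ultrametric_space U d" "ultrametric_space W e"
    and "common_zigzag Z V (assoc_set U d) (assoc_map U d) (assoc_set W e) (assoc_map W e)"
  shows "coarse_equivalent U d W e"
proof -
  interpret X: ultrametric_space U d by fact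
  interpret Y: ultrametric_space W e by fact
  obtain \<alpha> \<beta> where inc: "increasing \<alpha>" "increasing \<beta>" and zigzag:
    "\<forall>n\<ge>1. Z (2 * n - 1) = Inl ` assoc_set U d (\<alpha> n) \<and> Z (2 * n) = Inr ` assoc_set W e (\<beta> n) \<and>
      (\<forall>B \<in> assoc_set U d (\<alpha> n).
        V (2 * n) (V (2 * n - 1) (Inl B)) = Inl (subchain_map \<alpha> (assoc_map U d) n B)) \<and>
      (\<forall>B \<in> assoc_set W e (\<beta> n).
        V (2 * n + 1) (V (2 * n) (Inr B)) = Inr (subchain_map \<beta> (assoc_map W e) n B))"
    using assms(3) unfolding common_zigzag_def subchain_set_def by (elim conjE exE)
  note zigzag = zigzag[rule_format]
  note Zodd = zigzag[THEN conjunct1]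
  note Zeven = zigzag[THEN conjunct2, THEN conjunct1]
  note left = zigzag[THEN conjunct2, THEN conjunct2, THEN conjunct1, THEN bspec]
  note right = zigzag[THEN conjunct2, THEN conjunct2, THEN conjunct2, THEN bspec]
  have V_surj: "\<forall>n\<ge>1. V n ` Z n = Z (n + 1)"
    using assms(3) unfolding common_zigzag_def Dplus_chain_def by (elim conjE)
  have comp_left: "V (2 * n) (V (2 * n - 1) (Inl (X.mcball x (2 ^ \<alpha> n)))) =
      Inl (X.mcball x (2 ^ \<alpha> (Suc n)))" if n: "n \<ge> 1" and x: "x \<in> U" for n x
  proof -
    have "X.mcball x (2 ^ \<alpha> n) \<in> assoc_set U d (\<alpha> n)" using x by (simp add: assoc_set_def)
    from left[OF n this] show ?thesis
      unfolding X.subchain_map_assoc_mcball[OF x inc(1) n] by simp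
  qed
  have comp_right: "V (2 * n + 1) (V (2 * n) (Inr (Y.mcball y (2 ^ \<beta> n)))) =
      Inr (Y.mcball y (2 ^ \<beta> (Suc n)))" if n: "n \<ge> 1" and y: "y \<in> W" for n y
  proof -
    have "Y.mcball y (2 ^ \<beta> n) \<in> assoc_set W e (\<beta> n)" using y by (simp add: assoc_set_def)
    from right[OF n this] show ?thesis
      unfolding Y.subchain_map_assoc_mcball[OF y inc(2) n] by simp
  qed

  have Z1: "Z 1 = Inl ` assoc_set U d (\<alpha> 1)" using Zodd[of 1] by simp
  have Z2: "Z 2 = Inr ` assoc_set W e (\<beta> 1)" using Zeven[of 1] by simp
  have Z3: "Z 3 = Inl ` assoc_set U d (\<alpha> (Suc 1))" using Zodd[of "Suc 1"] by simp
  have image: "V 1 ` Z 1 = Z 2" "V 2 ` Z 2 = Z 3"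
    using V_surj[rule_format, of 1] V_surj[rule_format, of 2] by (simp_all del: One_nat_def)
  have "\<exists>y\<in>W. V 1 (Inl (X.mcball x (2 ^ \<alpha> 1))) = Inr (Y.mcball y (2 ^ \<beta> 1))" if "x \<in> U" for x
  proof -
    have "V 1 (Inl (X.mcball x (2 ^ \<alpha> 1))) \<in> Z 2"
      unfolding image(1)[symmetric] Z1 assoc_set_def using that by (intro imageI)
    then show ?thesis unfolding Z2 assoc_set_def by blast
  qed
  then obtain f where f: "\<And>x. x \<in> U \<Longrightarrow> f x \<in> W"
    and V1: "\<And>x. x \<in> U \<Longrightarrow> V 1 (Inl (X.mcball x (2 ^ \<alpha> 1))) = Inr (Y.mcball (f x) (2 ^ \<beta> 1))"
    by metis
  have "\<exists>x\<in>U. V 2 (Inr (Y.mcball y (2 ^ \<beta> 1))) = Inl (X.mcball x (2 ^ \<alpha> (Suc 1)))" if "y \<in> W" for y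
  proof -
    have "V 2 (Inr (Y.mcball y (2 ^ \<beta> 1))) \<in> Z 3"
      unfolding image(2)[symmetric] Z2 assoc_set_def using that by (intro imageI)
    then show ?thesis unfolding Z3 assoc_set_def by blast
  qed
  then obtain g where g: "\<And>y. y \<in> W \<Longrightarrow> g y \<in> U"
    and V2: "\<And>y. y \<in> W \<Longrightarrow> V 2 (Inr (Y.mcball y (2 ^ \<beta> 1))) = Inl (X.mcball (g y) (2 ^ \<alpha> (Suc 1)))"
    by metis
  \<comment> \<open>Two consecutive maps enlarge a ball without moving its centre. Hence a relation between the
      centres at the start of the zig-zag persists at all later positions.\<close>
  have Vodd: "V (2 * n - 1) (Inl (X.mcball x (2 ^ \<alpha> n))) = Inr (Y.mcball (f x) (2 ^ \<beta> n))"
    if x: "x \<in> U" and n: "n \<ge> 1" for n x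
    using n
  proof (induction n rule: dec_induct)
    case base
    then show ?case using V1[OF x] by simp
  next
    case (step n)
    then show ?case using step.IH comp_left[OF step(1) x] comp_right[OF step(1) f[OF x]] by simp
  qed
  have Veven: "V (2 * n) (Inr (Y.mcball y (2 ^ \<beta> n))) = Inl (X.mcball (g y) (2 ^ \<alpha> (Suc n)))"
    if y: "y \<in> W" and n: "n \<ge> 1" for n y
    using n
  proof (induction n rule: dec_induct)
    case base
    then show ?case using V2[OF y] by simp
  next
    case (step n)
    then show ?case using step.IH comp_right[OF step(1) y] comp_left[OF _ g[OF y], of "Suc n"] by simp
  qed

  show ?thesis
  proof (rule coarse_equivalentI)
    show "Metric_space U d" "Metric_space W e" "f \<in> U \<rightarrow> W" "g \<in> W \<rightarrow> U"
      using X.Metric_space_axioms Y.Metric_space_axioms f g by auto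
    show "bornologous U d W e f"
    proof (rule bornologousI_levels[of \<alpha>])
      fix n x x' assume "1 \<le> n" and x: "x \<in> U" "x' \<in> U" and "d x x' \<le> 2 ^ \<alpha> n"
      then have "Y.mcball (f x) (2 ^ \<beta> n) = Y.mcball (f x') (2 ^ \<beta> n)"
        using Vodd[of x n] Vodd[of x' n] X.mcball_eq[OF x] by simp
      then show "e (f x) (f x') \<le> 2 ^ \<beta> n" using f x by (simp add: Y.mcball_eq_iff)
    qed (rule increasing_ge[OF inc(1)])
    show "bornologous W e U d g"
    proof (rule bornologousI_levels[of \<beta>])
      fix n y y' assume "1 \<le> n" and y: "y \<in> W" "y' \<in> W" and "e y y' \<le> 2 ^ \<beta> n"
      then have "X.mcball (g y) (2 ^ \<alpha> (Suc n)) = X.mcball (g y') (2 ^ \<alpha> (Suc n))"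
        using Veven[of y n] Veven[of y' n] Y.mcball_eq[OF y] by simp
      then show "d (g y) (g y') \<le> 2 ^ \<alpha> (Suc n)" using g y by (simp add: X.mcball_eq_iff)
    qed (rule increasing_ge[OF inc(2)])
    show "close_maps U d (g \<circ> f) id"
    proof (rule close_maps_idI)
      fix x assume x: "x \<in> U"
      then have "X.mcball (g (f x)) (2 ^ \<alpha> (Suc 1)) = X.mcball x (2 ^ \<alpha> (Suc 1))"
        using comp_left[of 1 x] V1[of x] V2[of "f x"] f by simp
      then show "d ((g \<circ> f) x) x \<le> 2 ^ \<alpha> (Suc 1)" using f g x by (simp add: X.mcball_eq_iff)
    qed
    show "close_maps W e (f \<circ> g) id"
    proof (rule close_maps_idI)
      fix y assume y: "y \<in> W"
      then have "Y.mcball (f (g y)) (2 ^ \<beta> (Suc 1)) = Y.mcball y (2 ^ \<beta> (Suc 1))"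
        using comp_right[of 1 y] V2[of y] Vodd[of "g y" "Suc 1"] g by simp
      then show "e ((f \<circ> g) y) y \<le> 2 ^ \<beta> (Suc 1)" using f g y by (simp add: Y.mcball_eq_iff)
    qed
  qed
qed

theorem theorem4p8:
  fixes U\<^sub>1 :: "'a set" and d\<^sub>1 :: "'a \<Rightarrow> 'a \<Rightarrow> real"
    and U\<^sub>2 :: "'b set" and d\<^sub>2 :: "'b \<Rightarrow> 'b \<Rightarrow> real"
  assumes "ultrametric_space U\<^sub>1 d\<^sub>1" and "ultrametric_space U\<^sub>2 d\<^sub>2"
  shows "coarse_equivalent U\<^sub>1 d\<^sub>1 U\<^sub>2 d\<^sub>2 \<longleftrightarrow>
    (\<exists>Z V. common_zigzag Z V (assoc_set U\<^sub>1 d\<^sub>1) (assoc_map U\<^sub>1 d\<^sub>1)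
                             (assoc_set U\<^sub>2 d\<^sub>2) (assoc_map U\<^sub>2 d\<^sub>2))"
  using common_zigzag_if_coarse_equivalent[OF assms] coarse_equivalent_if_common_zigzag[OF assms]
  by blast

end
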